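(* Let $\boldsymbol{Z}=\{z_{i,j}\in\mathbb{F}^2: i,j\in\mathbb{N}\}$ be a node set and define $\boldsymbol{LZ}=\{w_{i,j}=z_{i+1,j}: i,j\in\mathbb{N}\}$ and $\boldsymbol{DZ}=\{w_{i,j}=z_{i,j+1}: i,j\in\mathbb{N}\}$. Then for all $m,n\in\mathbb{N}$, $$\Delta_x\tilde g_{m,n}((x,y);\boldsymbol{Z})=m\,\tilde g_{m-1,n}((x,y);\boldsymbol{LZ}),\qquad \Delta_y\tilde g_{m,n}((x,y);\boldsymbol{Z})=n\,\tilde g_{m,n-1}((x,y);\boldsymbol{DZ}),$$ where the right-hand side is interpreted as $0$ when $m=0$ (respectively $n=0$).
   Context: $\mathbb{F}$ is a field of characteristic zero. For $p\in\mathbb{F}[x,y]$, $\Delta_x p(x,y)=p(x,y)-p(x-1,y)$ and $\Delta_y p(x,y)=p(x,y)-p(x,y-1)$. For $z\in\mathbb{F}^2$, $\varepsilon(z)$ denotes evaluation at $(x,y)=z$. Write $(i,j)\preceq(m,n)$ if $i\le m$ and $j\le n$. $\Pi^2_{m,n}$ is the space of polynomials of degree at most $m$ in $x$ and at most $n$ in $y$. For a node set $\boldsymbol{W}=\{w_{i,j}\}$ and $m,n\in\mathbb{N}$, $\tilde g_{m,n}((x,y);\boldsymbol{W})$ is the unique polynomial in $\Pi^2_{m,n}$ with $\varepsilon(w_{i,j})\Delta_x^i\Delta_y^j\tilde g_{m,n}((x,y);\boldsymbol{W})=m!\,n!\,\delta_{m,i}\delta_{n,j}$ for all $(i,j)\preceq(m,n)$.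 *)

theory Defs
  imports "HOL-Computational_Algebra.Polynomial"
begin

text \<open>
  Bivariate polynomials over \<open>'a\<close> are elements of \<open>'a poly poly\<close>, read as
  polynomials in \<open>y\<close> (outer variable) with coefficients in \<open>'a[x]\<close> (inner variable).
\<close>

definition eval2 :: "'a::comm_ring_1 \<times> 'a \<Rightarrow> 'a poly poly \<Rightarrow> 'a" where
  "eval2 z p = poly (poly p [:snd z:]) (fst z)"

definition delta_x :: "'a::comm_ring_1 poly poly \<Rightarrow> 'a poly poly" where
  "delta_x p = p - map_poly (\<lambda>c. pcompose c [:-1, 1:]) p"

definition delta_y :: "'a::comm_ring_1 poly poly \<Rightarrow> 'a poly poly" where
  "delta_y p = p - pcompose p [:-1, 1:]"

lemma eval2_delta_y: "eval2 (a, b) (delta_y p) = eval2 (a, b) p - eval2 (a, b - 1) p"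
  by (simp add: eval2_def delta_y_def poly_pcompose one_pCons)

lemma eval2_delta_x: "eval2 (a, b) (delta_x p) = eval2 (a, b) p - eval2 (a - 1, b) p"
proof -
  have "poly (poly (map_poly (\<lambda>c. pcompose c [:-1, 1:]) p) [:b:]) a = poly (poly p [:b:]) (a - 1)"
    by (induction p) (simp_all add: map_poly_pCons poly_pcompose)
  then show ?thesis
    by (simp add: eval2_def delta_x_def)
qed

definition Pi2 :: "nat \<Rightarrow> nat \<Rightarrow> 'a::comm_ring_1 poly poly set" where
  "Pi2 m n = {p. degree p \<le> n \<and> (\<forall>k. degree (coeff p k) \<le> m)}"

text \<open>Node sets are families \<open>Z i j\<close> of (not necessarily distinct) points.\<close>

definition goncarov ::
    "(nat \<Rightarrow> nat \<Rightarrow> 'a::field_char_0 \<times> 'a) \<Rightarrow> nat \<Rightarrow> nat \<Rightarrow> 'a poly poly" where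
  "goncarov W m n = (THE p. p \<in> Pi2 m n \<and>
     (\<forall>i\<le>m. \<forall>j\<le>n. eval2 (W i j) ((delta_x ^^ i) ((delta_y ^^ j) p)) =
        (if i = m \<and> j = n then fact m * fact n else 0)))"

definition shift_L :: "(nat \<Rightarrow> nat \<Rightarrow> 'a \<times> 'a) \<Rightarrow> nat \<Rightarrow> nat \<Rightarrow> 'a \<times> 'a" where
  "shift_L Z = (\<lambda>i j. Z (i + 1) j)"

definition shift_D :: "(nat \<Rightarrow> nat \<Rightarrow> 'a \<times> 'a) \<Rightarrow> nat \<Rightarrow> nat \<Rightarrow> 'a \<times> 'a" where
  "shift_D Z = (\<lambda>i j. Z i (j + 1))"

end

theory Submission
  imports Defs
begin

text \<open>
  The Goncarov interpolation problem in \<open>Pi2 m n\<close> is uniquely solvable for arbitrary data: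
  by induction on \<open>m\<close>, the conditions with \<open>i > 0\<close> determine \<open>delta_x p\<close>, hence determine \<open>p\<close> up to
  a polynomial in \<open>y\<close> alone, and the conditions with \<open>i = 0\<close> are then a univariate problem of the
  same kind. Since \<open>delta_x\<close> of the Goncarov polynomial solves the problem for the shifted
  nodes with data scaled by \<open>m\<close>, uniqueness gives the recurrence; \<open>delta_y\<close> is analogous.
\<close>

section \<open>Univariate backward differences\<close>

text \<open>Kept over any commutative ring so that one operator serves twice: over \<open>'a\<close>
  it acts on the coefficients in \<open>delta_x p\<close>, over \<open>'a poly\<close> it is
  \<open>delta_y\<close> itself.\<close>

definition bdiff :: "'a::comm_ring_1 poly \<Rightarrow> 'a poly" where
  "bdiff p = p - pcompose p [:-1, 1:]"

lemma bdiff_0 [simp]: "bdiff 0 = 0"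
  by (simp add: bdiff_def)

lemma bdiff_diff: "bdiff (p - q) = bdiff p - bdiff q"
  by (simp add: bdiff_def pcompose_diff)

lemma bdiff_add: "bdiff (p + q) = bdiff p + bdiff q"
  by (simp add: bdiff_def pcompose_add)

text \<open>A product rule: the difference of x * p(x) is x * (p(x) - p(x-1)) + p(x-1), and p(x-1)
  equals \<open>p - bdiff p\<close>. It drives the later inductions over
  \<open>pCons\<close>.\<close>

lemma bdiff_pCons: "bdiff (pCons a p) = p + pCons 0 (bdiff p) - bdiff p"
proof -
  have "pCons a p = [:a:] + pCons 0 p"
    by simp
  then show ?thesis
    by (simp add: bdiff_def pcompose_pCons)
qed

lemma bdiff_const: "degree p = 0 \<Longrightarrow> bdiff p = 0"
  by (auto elim: degree_eq_zeroE simp: bdiff_def)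

text \<open>At the top coefficient \<open>bdiff\<close> acts like a derivative. Using a degree bound
  instead of the exact degree lets the induction pass to the tail of \<open>pCons\<close>.\<close>

lemma degree_coeff_bdiff:
  assumes "degree p \<le> Suc n"
  shows "degree (bdiff p) \<le> n \<and> coeff (bdiff p) n = of_nat (Suc n) * coeff p (Suc n)"
  using assms
proof (induction p arbitrary: n)
  case 0
  then show ?case by simp
next
  case (pCons a p)
  show ?case
  proof (cases n)
    case 0
    with pCons have "degree p = 0"
      by (auto split: if_splits)
    with 0 show ?thesis
      by (simp add: bdiff_pCons bdiff_const)
  next
    case (Suc k)
    with pCons have p: "degree p \<le> Suc k"
      by (auto split: if_splits)
    with pCons.IH have IH: "degree (bdiff p) \<le> k"
        "coeff (bdiff p) k = of_nat (Suc k) * coeff p (Suc k)"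
      by auto
    have "degree (p + pCons 0 (bdiff p) - bdiff p) \<le> Suc k"
      using p IH(1) degree_pCons_le[of 0 "bdiff p"]
      by (intro degree_diff_le degree_add_le) linarith+
    moreover have "coeff (bdiff p) (Suc k) = 0"
      using IH(1) by (intro coeff_eq_0) auto
    \<comment> \<open>The factor \<open>Suc k\<close> from the induction hypothesis grows by one
      through the summand \<open>p\<close>.\<close>
    moreover have "coeff (p + pCons 0 (bdiff p) - bdiff p) (Suc k) =
        of_nat (Suc (Suc k)) * coeff p (Suc k) - coeff (bdiff p) (Suc k)"
      by (simp add: IH(2) distrib_right add.assoc)
    ultimately show ?thesis
      unfolding Suc bdiff_pCons by simp
  qed
qed

lemma degree_bdiff_le: "degree p \<le> n \<Longrightarrow> degree (bdiff p) \<le> n - 1"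
  using degree_coeff_bdiff[of p "n - 1"] by (cases n) (simp_all add: bdiff_const)

text \<open>A positive degree n+1 would leave the coefficient n+1 times the leading one in
  \<open>bdiff p\<close>, which is nonzero in characteristic zero.\<close>

lemma bdiff_eq_0_imp_const:
  fixes p :: "'a::field_char_0 poly"
  assumes "bdiff p = 0"
  shows "degree p = 0"
proof (cases "degree p")
  case (Suc n)
  with assms have "of_nat (Suc n) * lead_coeff p = 0"
    using degree_coeff_bdiff[of p n] by simp
  then have "p = 0"
    by (simp del: of_nat_Suc)
  then show ?thesis by simp
qed

lemma ex_bdiff_eq:
  fixes q :: "'a::field_char_0 poly"
  assumes "degree q \<le> n"
  shows "\<exists>p. degree p \<le> Suc n \<and> bdiff p = q"
  using assms
proof (induction n arbitrary: q)
  case 0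
  then obtain c where "q = [:c:]"
    by (auto elim: degree_eq_zeroE)
  then show ?case
    by (intro exI[of _ "[:0, c:]"]) (simp add: bdiff_pCons)
next
  case (Suc n)
  \<comment> \<open>The scaling makes \<open>bdiff r\<close> match \<open>q\<close> in degree
    \<open>Suc n\<close>, so that subtracting it lowers the degree bound.\<close>
  define r where "r = monom (coeff q (Suc n) / of_nat (Suc (Suc n))) (Suc (Suc n))"
  have r: "degree r \<le> Suc (Suc n)"
    by (simp add: r_def degree_monom_le)
  have "degree (q - bdiff r) \<le> Suc n"
    using Suc.prems degree_coeff_bdiff[OF r] by (auto intro: degree_diff_le)
  moreover have "coeff (q - bdiff r) (Suc n) = 0"
    using degree_coeff_bdiff[OF r] by (simp add: r_def del: of_nat_Suc)
  ultimately have "degree (q - bdiff r) \<le> n"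
    by (metis coeff_0 degree_0 le_SucE leading_coeff_0_iff zero_le)
  then obtain p where p: "degree p \<le> Suc n" "bdiff p = q - bdiff r"
    using Suc.IH by blast
  with r show ?case
    by (intro exI[of _ "p + r"]) (auto simp: bdiff_add intro: degree_add_le)
qed

section \<open>Iterated differences and univariate interpolation\<close>

lemma funpow_diff:
  fixes f :: "'b::ab_group_add \<Rightarrow> 'b"
  assumes "\<And>p q. f (p - q) = f p - f q"
  shows "(f ^^ i) (p - q) = (f ^^ i) p - (f ^^ i) q"
  by (induction i) (simp_all add: assms)

lemma funpow_add_arg:
  fixes f :: "'b::ab_group_add \<Rightarrow> 'b"
  assumes "\<And>p q. f (p + q) = f p + f q"
  shows "(f ^^ i) (p + q) = (f ^^ i) p + (f ^^ i) q"
  by (induction i) (simp_all add: assms)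

text \<open>The conditions with j > 0 are the same problem for \<open>bdiff r\<close> at shifted
  nodes, so \<open>r\<close> is constant by induction, and the condition at j = 0 makes it
  zero.\<close>

lemma univariate_unique:
  fixes r :: "'a::field_char_0 poly"
  assumes "degree r \<le> n" "\<And>j. j \<le> n \<Longrightarrow> poly ((bdiff ^^ j) r) (t j) = 0"
  shows "r = 0"
proof -
  have const: "r = 0" if "degree r = 0" "poly r a = 0" for r :: "'a poly" and a
    using degree_eq_zeroE[OF that(1)] that(2) by fastforce
  show ?thesis
    using assms
  proof (induction n arbitrary: r t)
    case 0
    from 0(1) 0(2)[of 0] show ?case by (simp add: const)
  next
    case (Suc n)
    have "bdiff r = 0"
    proof (rule Suc.IH)
      show "degree (bdiff r) \<le> n"
        using Suc.prems(1) degree_coeff_bdiff by blast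
      show "poly ((bdiff ^^ j) (bdiff r)) (t (Suc j)) = 0" if "j \<le> n" for j
        using Suc.prems(2)[of "Suc j"] that by (simp add: funpow_swap1)
    qed
    then have "degree r = 0"
      by (rule bdiff_eq_0_imp_const)
    with Suc.prems(2)[of 0] show ?case
      by (simp add: const)
  qed
qed

lemma univariate_ex:
  fixes b t :: "nat \<Rightarrow> 'a::field_char_0"
  shows "\<exists>r. degree r \<le> n \<and> (\<forall>j\<le>n. poly ((bdiff ^^ j) r) (t j) = b j)"
proof (induction n arbitrary: b t)
  case 0
  show ?case by (intro exI[of _ "[:b 0:]"]) simp
next
  case (Suc n)
  from Suc.IH[of "t \<circ> Suc" "b \<circ> Suc"] obtain q where
    q: "degree q \<le> n" "\<And>j. j \<le> n \<Longrightarrow> poly ((bdiff ^^ j) q) (t (Suc j)) = b (Suc j)"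
    by auto
  obtain p where p: "degree p \<le> Suc n" "bdiff p = q"
    using ex_bdiff_eq[OF q(1)] by blast
  \<comment> \<open>The added constant corrects the value at \<open>t 0\<close> and is invisible to
    \<open>bdiff\<close>.\<close>
  define r where "r = p + [:b 0 - poly p (t 0):]"
  have "bdiff r = q"
    using p by (simp add: r_def bdiff_add bdiff_const)
  then have "poly ((bdiff ^^ j) r) (t j) = b j" if "j \<le> Suc n" for j
    using that q(2)[of "j - 1"] by (cases j) (simp_all add: r_def funpow_swap1)
  moreover have "degree r \<le> Suc n"
    using p by (auto simp: r_def intro: degree_add_le)
  ultimately show ?case by blast
qed

section \<open>Bivariate difference operators\<close>

lemma delta_y_eq_bdiff: "delta_y = bdiff"
  by (simp add: fun_eq_iff delta_y_def bdiff_def)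

lemma coeff_delta_x: "coeff (delta_x p) k = bdiff (coeff p k)"
  by (simp add: delta_x_def bdiff_def coeff_map_poly)

lemma delta_x_0 [simp]: "delta_x 0 = 0"
  by (simp add: delta_x_def)

lemma delta_x_diff: "delta_x (p - q) = delta_x p - delta_x q"
  by (rule poly_eqI) (simp add: coeff_delta_x bdiff_diff)

lemma delta_x_add: "delta_x (p + q) = delta_x p + delta_x q"
  by (rule poly_eqI) (simp add: coeff_delta_x bdiff_add)

lemma delta_x_pCons: "delta_x (pCons a p) = pCons (bdiff a) (delta_x p)"
  by (rule poly_eqI) (simp add: coeff_delta_x coeff_pCons split: nat.split)

text \<open>Shifts in different variables commute. This lets \<open>delta_x\<close> move past
  iterates of \<open>delta_y\<close> in the interpolation conditions.\<close>

lemma delta_x_delta_y: "delta_x (delta_y p) = delta_y (delta_x p)"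
  by (induction p)
    (simp_all add: delta_y_eq_bdiff delta_x_pCons bdiff_pCons delta_x_add delta_x_diff)

lemma funpow_delta_y_delta_x: "(delta_y ^^ j) (delta_x p) = delta_x ((delta_y ^^ j) p)"
  by (induction j) (simp_all add: delta_x_delta_y)

lemma funpow_delta_x_delta_y: "(delta_x ^^ i) (delta_y p) = delta_y ((delta_x ^^ i) p)"
  by (induction i) (simp_all add: delta_x_delta_y)

lemma delta_x_in_Pi2:
  assumes "p \<in> Pi2 m n"
  shows "delta_x p \<in> Pi2 (m - 1) n"
proof -
  have "degree (delta_x p) \<le> n"
    using assms by (auto simp: Pi2_def coeff_delta_x coeff_eq_0 intro!: degree_le)
  moreover have "degree (coeff (delta_x p) k) \<le> m - 1" for k
    using assms unfolding Pi2_def coeff_delta_x by (blast intro: degree_bdiff_le)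
  ultimately show ?thesis
    by (simp add: Pi2_def)
qed

text \<open>A difference in y only forms integer combinations of the coefficients in x, so it cannot
  raise the degree in x.\<close>

lemma degree_coeff_bdiff_le:
  fixes p :: "'a::comm_ring_1 poly poly"
  assumes "\<And>k. degree (coeff p k) \<le> m"
  shows "degree (coeff (bdiff p) k) \<le> m"
  using assms
proof (induction p arbitrary: k)
  case 0
  then show ?case by simp
next
  case (pCons a p)
  have p: "degree (coeff p k) \<le> m" for k
    using pCons.prems[of "Suc k"] by simp
  with pCons.IH have IH: "degree (coeff (bdiff p) k) \<le> m" for k
    by blast
  show ?case
    unfolding bdiff_pCons coeff_diff coeff_add
    by (intro degree_diff_le degree_add_le p IH) (simp add: coeff_pCons IH split: nat.split)
qed

lemma delta_y_in_Pi2: "p \<in> Pi2 m n \<Longrightarrow> delta_y p \<in> Pi2 m (n - 1)"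
  unfolding Pi2_def mem_Collect_eq delta_y_eq_bdiff
  by (blast intro: degree_bdiff_le degree_coeff_bdiff_le)

lemma diff_in_Pi2: "p \<in> Pi2 m n \<Longrightarrow> q \<in> Pi2 m n \<Longrightarrow> p - q \<in> Pi2 m n"
  by (auto simp: Pi2_def intro: degree_diff_le)

lemma of_nat_mult_in_Pi2: "p \<in> Pi2 m n \<Longrightarrow> of_nat k * p \<in> Pi2 m n"
  unfolding Pi2_def of_nat_poly[of k]
  by (auto simp: of_nat_poly intro: order.trans[OF degree_smult_le])

section \<open>Polynomials in y alone and antidifferences in x\<close>

definition const_x :: "'a::comm_ring_1 poly \<Rightarrow> 'a poly poly" where
  "const_x r = map_poly (\<lambda>c. [:c:]) r"

lemma coeff_const_x [simp]: "coeff (const_x r) k = [:coeff r k:]"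
  by (simp add: const_x_def coeff_map_poly)

lemma const_x_0 [simp]: "const_x 0 = 0"
  by (simp add: const_x_def)

lemma const_x_pCons [simp]: "const_x (pCons a r) = pCons [:a:] (const_x r)"
  by (rule poly_eqI) (simp add: coeff_pCons split: nat.split)

lemma eval2_const_x: "eval2 z (const_x r) = poly r (snd z)"
  by (induction r) (simp_all add: eval2_def)

lemma delta_x_const_x [simp]: "delta_x (const_x r) = 0"
  by (rule poly_eqI) (simp add: coeff_delta_x bdiff_const)

lemma delta_y_const_x: "delta_y (const_x r) = const_x (bdiff r)"
proof (induction r)
  case 0
  then show ?case by (simp add: delta_y_eq_bdiff)
next
  case (pCons a r)
  then have "coeff (bdiff (const_x r)) k = [:coeff (bdiff r) k:]" for k
    by (simp add: delta_y_eq_bdiff)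
  then show ?case
    by (intro poly_eqI)
      (simp add: delta_y_eq_bdiff bdiff_pCons coeff_pCons split: nat.split)
qed

lemma funpow_delta_y_const_x: "(delta_y ^^ j) (const_x r) = const_x ((bdiff ^^ j) r)"
  by (induction j) (simp_all add: delta_y_const_x)

lemma const_x_in_Pi2: "degree r \<le> n \<Longrightarrow> const_x r \<in> Pi2 m n"
  by (auto simp: Pi2_def coeff_eq_0 intro!: degree_le)

text \<open>Together with \<open>bdiff_eq_0_imp_const\<close> this shows that a polynomial killed by
  \<open>delta_x\<close> depends on y alone.\<close>

lemma Pi2_const_xE:
  assumes "p \<in> Pi2 m n" "\<And>k. degree (coeff p k) = 0"
  obtains r where "p = const_x r" "degree r \<le> n"
proof
  show "p = const_x (map_poly (\<lambda>c. coeff c 0) p)"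
  proof (rule poly_eqI)
    fix k
    from assms(2)[of k] show "coeff p k = coeff (const_x (map_poly (\<lambda>c. coeff c 0) p)) k"
      by (auto elim: degree_eq_zeroE simp: coeff_map_poly)
  qed
  show "degree (map_poly (\<lambda>c. coeff c 0) p) \<le> n"
    using assms(1) by (auto simp: Pi2_def coeff_map_poly coeff_eq_0 intro!: degree_le)
qed

lemma ex_delta_x_eq:
  fixes q :: "'a::field_char_0 poly poly"
  assumes "q \<in> Pi2 m n"
  shows "\<exists>p \<in> Pi2 (Suc m) n. delta_x p = q"
proof -
  \<comment> \<open>Antidifferences are chosen coefficientwise; taking 0 wherever \<open>q\<close>
    has coefficient 0 keeps the family finite and the degree in y at most \<open>n\<close>.\<close>
  have "\<forall>k. \<exists>c. degree c \<le> Suc m \<and> bdiff c = coeff q k \<and> (coeff q k = 0 \<longrightarrow> c = 0)"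
  proof
    fix k
    from assms have "degree (coeff q k) \<le> m"
      by (simp add: Pi2_def)
    then show "\<exists>c. degree c \<le> Suc m \<and> bdiff c = coeff q k \<and> (coeff q k = 0 \<longrightarrow> c = 0)"
      using ex_bdiff_eq[of "coeff q k" m] by (cases "coeff q k = 0") auto
  qed
  then obtain c where c: "\<And>k. degree (c k) \<le> Suc m" "\<And>k. bdiff (c k) = coeff q k"
      "\<And>k. coeff q k = 0 \<Longrightarrow> c k = 0"
    by metis
  have c0: "c k = 0" if "k > n" for k
    using that assms by (intro c(3) coeff_eq_0) (simp add: Pi2_def)
  define p where "p = Abs_poly c"
  have p: "coeff p k = c k" for k
    unfolding p_def using c0 by (subst coeff_Abs_poly[of n]) auto
  have "p \<in> Pi2 (Suc m) n"
    using c(1) c0 by (auto simp: Pi2_def p intro!: degree_le)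
  moreover have "delta_x p = q"
    by (rule poly_eqI) (simp add: coeff_delta_x p c(2))
  ultimately show ?thesis by blast
qed

section \<open>The interpolation problem\<close>

definition eval_delta :: "'a::comm_ring_1 \<times> 'a \<Rightarrow> nat \<Rightarrow> nat \<Rightarrow> 'a poly poly \<Rightarrow> 'a" where
  "eval_delta z i j p = eval2 z ((delta_x ^^ i) ((delta_y ^^ j) p))"

lemma eval_delta_diff: "eval_delta z i j (p - q) = eval_delta z i j p - eval_delta z i j q"
  by (simp add: eval_delta_def funpow_diff delta_x_diff delta_y_eq_bdiff bdiff_diff eval2_def)

lemma eval_delta_add: "eval_delta z i j (p + q) = eval_delta z i j p + eval_delta z i j q"
  by (simp add: eval_delta_def funpow_add_arg delta_x_add delta_y_eq_bdiff bdiff_add eval2_def)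

lemma eval_delta_of_nat_mult: "eval_delta z i j (of_nat k * p) = of_nat k * eval_delta z i j p"
proof (induction k)
  case 0
  \<comment> \<open>The value at 0 comes from writing 0 as \<open>p - p\<close>.\<close>
  show ?case using eval_delta_diff[of z i j p p] by simp
next
  case (Suc k)
  then show ?case by (simp add: algebra_simps eval_delta_add)
qed

text \<open>Raising the first index by one is what turns the nodes into
  \<open>shift_L\<close>.\<close>

lemma eval_delta_delta_x: "eval_delta z i j (delta_x p) = eval_delta z (Suc i) j p"
  by (simp add: eval_delta_def funpow_delta_y_delta_x funpow_swap1)

lemma eval_delta_delta_y: "eval_delta z i j (delta_y p) = eval_delta z i (Suc j) p"
  by (simp add: eval_delta_def funpow_delta_x_delta_y funpow_swap1)

lemma eval_delta_const_x: "eval_delta z 0 j (const_x r) = poly ((bdiff ^^ j) r) (snd z)"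
  by (simp add: eval_delta_def funpow_delta_y_const_x eval2_const_x)

text \<open>Arbitrary data \<open>b\<close> are carried along because the row i = 0 is repaired by
  prescribing the errors of an intermediate solution.\<close>

lemma interpolation_ex:
  fixes W :: "nat \<Rightarrow> nat \<Rightarrow> 'a::field_char_0 \<times> 'a"
  shows "\<exists>p \<in> Pi2 m n. \<forall>i\<le>m. \<forall>j\<le>n. eval_delta (W i j) i j p = b i j"
proof (induction m arbitrary: W b)
  case 0
  obtain r where r: "degree r \<le> n" "\<forall>j\<le>n. poly ((bdiff ^^ j) r) (snd (W 0 j)) = b 0 j"
    using univariate_ex[of n "\<lambda>j. snd (W 0 j)" "b 0"] by blast
  then show ?case
    by (intro bexI[of _ "const_x r"]) (simp_all add: eval_delta_const_x const_x_in_Pi2)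
next
  case (Suc m)
  from Suc.IH[of "W \<circ> Suc" "b \<circ> Suc"] obtain q where q: "q \<in> Pi2 m n"
      "\<And>i j. i \<le> m \<Longrightarrow> j \<le> n \<Longrightarrow> eval_delta (W (Suc i) j) i j q = b (Suc i) j"
    by auto
  obtain p where p: "p \<in> Pi2 (Suc m) n" "delta_x p = q"
    using ex_delta_x_eq[OF q(1)] by blast
  \<comment> \<open>\<open>r\<close> interpolates the error of \<open>p\<close> in row 0.
    Subtracting \<open>const_x r\<close> leaves the rows i > 0 intact, since \<open>delta_x\<close>
    annihilates it.\<close>
  obtain r where r: "degree r \<le> n"
      "\<And>j. j \<le> n \<Longrightarrow>
        poly ((bdiff ^^ j) r) (snd (W 0 j)) = eval_delta (W 0 j) 0 j p - b 0 j"
    using univariate_ex[of n "\<lambda>j. snd (W 0 j)" "\<lambda>j. eval_delta (W 0 j) 0 j p - b 0 j"]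
    by blast
  have "eval_delta (W i j) i j (p - const_x r) = b i j" if "i \<le> Suc m" "j \<le> n" for i j
  proof (cases i)
    case 0
    with r(2) that show ?thesis by (simp add: eval_delta_diff eval_delta_const_x)
  next
    case (Suc k)
    with q(2)[of k j] that p(2) show ?thesis
      by (simp add: delta_x_diff flip: eval_delta_delta_x)
  qed
  moreover have "p - const_x r \<in> Pi2 (Suc m) n"
    using p(1) r(1) by (intro diff_in_Pi2 const_x_in_Pi2)
  ultimately show ?case by blast
qed

text \<open>The rows i > 0 force \<open>delta_x p = 0\<close> by induction; then \<open>p\<close>
  depends on y alone and row 0 is the univariate problem.\<close>

lemma interpolation_zero:
  fixes W :: "nat \<Rightarrow> nat \<Rightarrow> 'a::field_char_0 \<times> 'a"
  assumes "p \<in> Pi2 m n" "\<And>i j. i \<le> m \<Longrightarrow> j \<le> n \<Longrightarrow> eval_delta (W i j) i j p = 0"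
  shows "p = 0"
  using assms
proof (induction m arbitrary: W p)
  case 0
  then have "degree (coeff p k) = 0" for k
    by (simp add: Pi2_def)
  with 0(1) obtain r where "p = const_x r" "degree r \<le> n"
    using Pi2_const_xE by blast
  with 0 show ?case
    using univariate_unique[of r n "\<lambda>j. snd (W 0 j)"] by (simp add: eval_delta_const_x)
next
  case (Suc m)
  have "delta_x p = 0"
  proof (rule Suc.IH)
    show "delta_x p \<in> Pi2 m n"
      using delta_x_in_Pi2[OF Suc.prems(1)] by simp
    show "eval_delta (W (Suc i) j) i j (delta_x p) = 0" if "i \<le> m" "j \<le> n" for i j
      using Suc.prems(2)[of "Suc i" j] that by (simp add: eval_delta_delta_x)
  qed
  then have "degree (coeff p k) = 0" for k
    by (metis bdiff_eq_0_imp_const coeff_0 coeff_delta_x)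
  with Suc.prems(1) obtain r where "p = const_x r" "degree r \<le> n"
    using Pi2_const_xE by blast
  with Suc.prems(2)[of 0] show ?case
    using univariate_unique[of r n "\<lambda>j. snd (W 0 j)"] by (simp add: eval_delta_const_x)
qed

lemma interpolation_unique:
  fixes W :: "nat \<Rightarrow> nat \<Rightarrow> 'a::field_char_0 \<times> 'a"
  assumes "p \<in> Pi2 m n" "q \<in> Pi2 m n"
    and "\<And>i j. i \<le> m \<Longrightarrow> j \<le> n \<Longrightarrow> eval_delta (W i j) i j p = eval_delta (W i j) i j q"
  shows "p = q"
proof -
  have "p - q = 0"
    using assms by (intro interpolation_zero[of _ m n W]) (simp_all add: diff_in_Pi2 eval_delta_diff)
  then show ?thesis by simp
qed

section \<open>Goncarov polynomials and their recurrences\<close>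

lemma goncarov_props:
  fixes W :: "nat \<Rightarrow> nat \<Rightarrow> 'a::field_char_0 \<times> 'a"
  shows goncarov_in_Pi2: "goncarov W m n \<in> Pi2 m n"
    and eval_delta_goncarov: "i \<le> m \<Longrightarrow> j \<le> n \<Longrightarrow>
      eval_delta (W i j) i j (goncarov W m n) = (if i = m \<and> j = n then fact m * fact n else 0)"
proof -
  let ?P = "\<lambda>p. p \<in> Pi2 m n \<and> (\<forall>i\<le>m. \<forall>j\<le>n. eval_delta (W i j) i j p =
      (if i = m \<and> j = n then fact m * fact n else 0))"
  have "\<exists>!p. ?P p"
  proof (rule ex_ex1I)
    show "\<exists>p. ?P p"
      using interpolation_ex[of m n W "\<lambda>i j. if i = m \<and> j = n then fact m * fact n else 0"]
      by blast
    show "p = q" if "?P p" "?P q" for p q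
      using that by (intro interpolation_unique[of p m n q W]) auto
  qed
  then have "?P (goncarov W m n)"
    unfolding goncarov_def eval_delta_def by (rule theI')
  then show "goncarov W m n \<in> Pi2 m n"
    and "i \<le> m \<Longrightarrow> j \<le> n \<Longrightarrow>
      eval_delta (W i j) i j (goncarov W m n) = (if i = m \<and> j = n then fact m * fact n else 0)"
    by auto
qed

lemma delta_x_goncarov_0: "delta_x (goncarov W 0 n) = 0"
  using goncarov_in_Pi2[of W 0 n]
  by (intro poly_eqI) (simp add: coeff_delta_x Pi2_def bdiff_const)

lemma delta_y_goncarov_0: "delta_y (goncarov W m 0) = 0"
  using goncarov_in_Pi2[of W m 0] by (simp add: delta_y_eq_bdiff Pi2_def bdiff_const)

text \<open>Both sides have the same data at the shifted nodes: the only nonzero value is (m+1)! n!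
  = (m+1) (m! n!), at index (m, n).\<close>

lemma delta_x_goncarov_Suc:
  "delta_x (goncarov W (Suc m) n) = of_nat (Suc m) * goncarov (shift_L W) m n"
proof (rule interpolation_unique[where W = "shift_L W"])
  show "delta_x (goncarov W (Suc m) n) \<in> Pi2 m n"
    using delta_x_in_Pi2[OF goncarov_in_Pi2[of W "Suc m" n]] by simp
  show "of_nat (Suc m) * goncarov (shift_L W) m n \<in> Pi2 m n"
    by (intro of_nat_mult_in_Pi2 goncarov_in_Pi2)
  show "eval_delta (shift_L W i j) i j (delta_x (goncarov W (Suc m) n)) =
      eval_delta (shift_L W i j) i j (of_nat (Suc m) * goncarov (shift_L W) m n)"
    if "i \<le> m" "j \<le> n" for i j
    using that eval_delta_goncarov[of "Suc i" "Suc m" j n W]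
      eval_delta_goncarov[of i m j n "shift_L W"]
    by (simp add: eval_delta_of_nat_mult eval_delta_delta_x shift_L_def del: of_nat_Suc)
qed

lemma delta_y_goncarov_Suc:
  "delta_y (goncarov W m (Suc n)) = of_nat (Suc n) * goncarov (shift_D W) m n"
proof (rule interpolation_unique[where W = "shift_D W"])
  show "delta_y (goncarov W m (Suc n)) \<in> Pi2 m n"
    using delta_y_in_Pi2[OF goncarov_in_Pi2[of W m "Suc n"]] by simp
  show "of_nat (Suc n) * goncarov (shift_D W) m n \<in> Pi2 m n"
    by (intro of_nat_mult_in_Pi2 goncarov_in_Pi2)
  show "eval_delta (shift_D W i j) i j (delta_y (goncarov W m (Suc n))) =
      eval_delta (shift_D W i j) i j (of_nat (Suc n) * goncarov (shift_D W) m n)"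
    if "i \<le> m" "j \<le> n" for i j
    using that eval_delta_goncarov[of i m "Suc j" "Suc n" W]
      eval_delta_goncarov[of i m j n "shift_D W"]
    by (simp add: eval_delta_of_nat_mult eval_delta_delta_y shift_D_def del: of_nat_Suc)
qed

theorem theorem5:
  fixes Z :: "nat \<Rightarrow> nat \<Rightarrow> 'a::field_char_0 \<times> 'a" and m n :: nat
  shows "delta_x (goncarov Z m n) =
           (if m = 0 then 0 else of_nat m * goncarov (shift_L Z) (m - 1) n) \<and>
         delta_y (goncarov Z m n) =
           (if n = 0 then 0 else of_nat n * goncarov (shift_D Z) m (n - 1))"
  by (cases m; cases n) (simp_all add: delta_x_goncarov_0 delta_y_goncarov_0
      delta_x_goncarov_Suc delta_y_goncarov_Suc del: of_nat_Suc)

end
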